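(* Let $p$ and $q$ be nonzero integers with $p - q \neq 1$. Let $(V_n)_{n\ge0}$ be defined by $V_0=2$, $V_1=p$, and $V_n = pV_{n-1}-qV_{n-2}$ for $n\ge2$. Then for all $n \geq 1$, $$\sum_{i=1}^n i\, V_i = \frac{1}{p-q-1} \left( n (V_{n+1} - q V_n) + 2 q - \frac{\Psi(n)}{p-q-1} \right),$$ where $\Psi(n) = V_{n+1} - 2q V_n + q^2 V_{n-1} +(p-2q)(q-1)$.
   Context: $(V_n)$ is the Lucas sequence of the second kind with parameters $p,q$. *)

theory Defs
  imports Complex_Main
begin

fun lucas_V :: "int \<Rightarrow> int \<Rightarrow> nat \<Rightarrow> int" where
  "lucas_V p q 0 = 2"
| "lucas_V p q (Suc 0) = p"
| "lucas_V p q (Suc (Suc n)) = p * lucas_V p q (Suc n) - q * lucas_V p q n"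

(* Only meant for n \<ge> 1: for n = 0 the index n - 1 is truncated to 0. *)
definition Psi :: "int \<Rightarrow> int \<Rightarrow> nat \<Rightarrow> int" where
  "Psi p q n = lucas_V p q (n + 1) - 2 * q * lucas_V p q n + q^2 * lucas_V p q (n - 1)
     + (p - 2 * q) * (q - 1)"

end

theory Submission
  imports Defs
begin

text \<open>Summation by parts, twice. Put d = p - q - 1 and T_n = V_{n+1} - q V_n. The recurrence
  gives T_n - T_{n-1} = d V_n, so d times the sum is n T_n - (T_0 + ... + T_{n-1}). Likewise Psi(n)
  - Psi(n-1) = d T_{n-1} for n \<ge> 2; with Psi(1) = p d and T_0 = p - 2q, the T-sum is Psi(n)/d -
  2q.\<close>

text \<open>Multiplying by d^2 keeps the induction in the integers, and the index
  \<open>Suc m\<close> avoids truncation in \<open>Psi\<close>.\<close>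

lemma lucas_V_weighted_sum:
  fixes p q :: int
  shows "(p - q - 1)^2 * (\<Sum>i = 1..Suc m. int i * lucas_V p q i) =
    (p - q - 1) * (int (Suc m) * (lucas_V p q (Suc (Suc m)) - q * lucas_V p q (Suc m)) + 2 * q)
      - Psi p q (Suc m)"
proof (induction m)
  case 0
  show ?case
    by (simp add: Psi_def algebra_simps power2_eq_square)
next
  case (Suc m)
  define a b where "a = lucas_V p q m" and "b = lucas_V p q (Suc m)"
  have "(p - q - 1)^2 * (\<Sum>i = 1..Suc (Suc m). int i * lucas_V p q i) =
    (p - q - 1)^2 * (\<Sum>i = 1..Suc m. int i * lucas_V p q i)
      + (p - q - 1)^2 * (int (Suc (Suc m)) * lucas_V p q (Suc (Suc m)))"
    by (simp add: distrib_left)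
  then show ?case
    unfolding Suc.IH
    \<comment> \<open>The recurrence reduces every term to \<open>a\<close> and \<open>b\<close>,
      leaving a polynomial identity.\<close>
    by (simp add: Psi_def algebra_simps power2_eq_square flip: a_def b_def)
qed

theorem theorem4p8:
  fixes p q :: int and n :: nat
  assumes "p \<noteq> 0" and "q \<noteq> 0" and "p - q \<noteq> 1" and "n \<ge> 1"
  shows "(\<Sum>i = 1..n. real i * real_of_int (lucas_V p q i)) =
    1 / real_of_int (p - q - 1) *
      (real n * real_of_int (lucas_V p q (n + 1) - q * lucas_V p q n) + 2 * real_of_int q
        - real_of_int (Psi p q n) / real_of_int (p - q - 1))"
proof -
  obtain m where m: "n = Suc m"
    using \<open>n \<ge> 1\<close> by (cases n) auto
  define d S W P where "d = real_of_int (p - q - 1)"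
    and "S = (\<Sum>i = 1..n. real i * real_of_int (lucas_V p q i))"
    and "W = real n * real_of_int (lucas_V p q (n + 1) - q * lucas_V p q n) + 2 * real_of_int q"
    and "P = real_of_int (Psi p q n)"
  have "d \<noteq> 0"
    using \<open>p - q \<noteq> 1\<close> unfolding d_def of_int_eq_0_iff by simp
  have "d^2 * S = d * W - P"
    using arg_cong[OF lucas_V_weighted_sum[of p q m], of real_of_int]
    unfolding d_def S_def W_def P_def m
    \<comment> \<open>Only casts should move: unfolding the recurrence or splitting off the last
      summand would disturb terms that already match.\<close>
    by (simp del: lucas_V.simps sum.cl_ivl_Suc)
  with \<open>d \<noteq> 0\<close> have "S = 1 / d * (W - P / d)"
    by (simp add: field_simps power2_eq_square)
  then show ?thesis
    unfolding d_def S_def W_def P_def .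
qed

end
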